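(* Let $A$ be a bdsw matrix. Then $A\in\mathbf{Q}$ if and only if $A\in\mathbf{R}_0$ and $\deg A=\pm 1$.
   Context: A matrix $A=[a_{ij}]\in\mathbb{R}^{n\times n}$, $n\ge 2$, is a bidiagonal southwest (bdsw) matrix if $a_{ij}=0$ unless $j=i$, or $j=i+1$, or $(i,j)=(n,1)$; the entries in these positions are arbitrary real numbers (possibly zero). For $A\in\mathbb{R}^{n\times n}$ and $q\in\mathbb{R}^n$, $\mathrm{LCP}(A,q)$ is the problem of finding $x\in\mathbb{R}^n$ with $x\ge 0$, $Ax+q\ge 0$ and $x^\top(Ax+q)=0$ (componentwise inequalities). $A\in\mathbf{Q}$ if $\mathrm{LCP}(A,q)$ has a solution for every $q\in\mathbb{R}^n$. $A\in\mathbf{R}_0$ if $x=0$ is the only solution of $\mathrm{LCP}(A,0)$. For $A\in\mathbf{R}_0$, let $f(x):=\min\{x,Ax\}$ (componentwise minimum) on $\mathbb{R}^n$; then $f(x)=0$ only for $x=0$, and $\deg A:=\deg(f,\Omega,0)$ is the topological (Brouwer) degree of $f$ at $0$ relative to any bounded open set $\Omega\subset\mathbb{R}^n$ containing $0$. *)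

theory Defs
  imports "HOL-Analysis.Analysis" "HOL-Homology.Homology"
begin

text \<open>Brouwer degree in its homological form (Dold, Lectures on Algebraic Topology, IV.5 and
  VIII.4). Let \<open>U\<close> be bounded and open, \<open>f\<close> continuous on \<open>closure U\<close>, \<open>y \<notin> f ` frontier U\<close>,
  so that \<open>K = {x \<in> U. f x = y}\<close> is compact, and let \<open>m\<close> be the dimension of the space \<open>E\<close>.
  A class \<open>u\<close> in \<open>H\<^sub>m(E, E - B)\<close>, with \<open>B\<close> a closed ball containing \<open>K\<close> and \<open>y\<close>, restricts to
  \<open>H\<^sub>m(E, E - K)\<close>, which is \<open>H\<^sub>m(U, U - K)\<close> by excision, and is then pushed forward
  to \<open>H\<^sub>m(E, E - {y})\<close> by \<open>f\<close>. The degree is the integer \<open>d\<close> for which the result is \<open>d\<close> times the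
  restriction of \<open>u\<close> to \<open>H\<^sub>m(E, E - {y})\<close>. Both restrictions come from the same \<open>u\<close>, so no choice
  of orientation enters. Homology groups are written multiplicatively in the library.\<close>

definition brouwer_degree :: "('a::euclidean_space \<Rightarrow> 'a) \<Rightarrow> 'a set \<Rightarrow> 'a \<Rightarrow> int"
  where
  "brouwer_degree f U y =
    (let m = int DIM('a); K = {x \<in> U. f x = y} in
     THE d::int. \<forall>r u c.
       insert y K \<subseteq> cball 0 r \<longrightarrow>
       u \<in> carrier (relative_homology_group m (euclidean :: 'a topology) (- cball 0 r)) \<longrightarrow>
       c \<in> carrier (relative_homology_group m (top_of_set U) (U - K)) \<longrightarrow>
       hom_induced m (top_of_set U) (U - K) euclidean (- K) id c =
         hom_induced m euclidean (- cball 0 r) euclidean (- K) id u \<longrightarrow>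
       hom_induced m (top_of_set U) (U - K) euclidean (- {y}) f c =
         (hom_induced m euclidean (- cball 0 r) euclidean (- {y}) id u)
           [^]\<^bsub>relative_homology_group m (euclidean :: 'a topology) (- {y})\<^esub> d)"

definition LCP_solution :: "real^'n^'n \<Rightarrow> real^'n \<Rightarrow> real^'n \<Rightarrow> bool"
  where
  "LCP_solution A q x \<longleftrightarrow> 0 \<le> x \<and> 0 \<le> A *v x + q \<and> x \<bullet> (A *v x + q) = 0"

definition Q_matrix :: "real^'n^'n \<Rightarrow> bool"
  where
  "Q_matrix A \<longleftrightarrow> (\<forall>q. \<exists>x. LCP_solution A q x)"

definition R0_matrix :: "real^'n^'n \<Rightarrow> bool"
  where
  "R0_matrix A \<longleftrightarrow> (\<forall>x. LCP_solution A 0 x \<longleftrightarrow> x = 0)"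

definition min_map :: "real^'n^'n \<Rightarrow> real^'n \<Rightarrow> real^'n"
  where
  "min_map A x = (\<chi> i. min (x $ i) ((A *v x) $ i))"

text \<open>The index type carries no order; \<open>e\<close> is the numbering \<open>1, \<dots>, n\<close> of its elements.\<close>

definition bdsw :: "(nat \<Rightarrow> 'n::finite) \<Rightarrow> real^'n^'n \<Rightarrow> bool"
  where
  "bdsw e A \<longleftrightarrow>
    (\<forall>i\<in>{1..CARD('n)}. \<forall>j\<in>{1..CARD('n)}.
       \<not> (j = i \<or> j = i + 1 \<or> (i, j) = (CARD('n), 1)) \<longrightarrow> A $ e i $ e j = 0)"

end

(* The degree of a map f of Euclidean space vanishing only at 0 is read off the induced
   endomorphism of H_n(E, E - {0}), which is infinite cyclic, so it is invariant under homotopies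
   whose zero stays at 0. If A is R0 but LCP(A, q) is unsolvable, then min(x, A x + t q) deforms
   the min map to one that misses 0, so the degree is 0.

   Conversely, row i of a bdsw matrix only involves x_i and x_(i+1), with coefficients d_i and s_i,
   so equations and zeros propagate around a cycle. Testing Q against a few sign vectors q leaves
   two cases. If all d_i >= 0, then A + tau I is R0 for all tau >= 0 and the min map is homotopic
   to the identity. If some d_i < 0, then d_i s_i < 0 for all i, and for the vector q that is -1
   where d_i < 0 and 0 elsewhere, LCP(A, q) has exactly one solution p, and p > 0. Then A is
   invertible and min(y + c |y| p, A y), for c from 0 to a large constant, deforms the min map
   to A. *)
theory Submission
  imports Defs
begin

section \<open>Degree of maps vanishing only at the origin\<close>

lemma homotopic_with_euclideanI:
  fixes H :: "real \<times> 'a::euclidean_space \<Rightarrow> 'b::euclidean_space"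
  assumes "continuous_on UNIV H"
    and "\<And>t x. 0 \<le> t \<Longrightarrow> t \<le> 1 \<Longrightarrow> x \<in> S \<Longrightarrow> H (t, x) \<in> T"
  shows "homotopic_with (\<lambda>h. h \<in> S \<rightarrow> T) euclidean euclidean (\<lambda>x. H (0, x)) (\<lambda>x. H (1, x))"
proof -
  have eq: "prod_topology (top_of_set {0..1::real}) (euclidean :: 'a topology) = top_of_set ({0..1} \<times> UNIV)"
    by (metis prod_topology_subtopology_eu subtopology_UNIV)
  show ?thesis
    unfolding homotopic_with_def eq
    using assms by (intro exI[of _ H]) (auto intro: continuous_on_subset)
qed

text \<open>The library computes in \<open>Euclidean_space n\<close>, a space of sequences: adding
  \<open>n\<close> coordinates to the one-point space \<open>Euclidean_space 0\<close> shifts the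
  relative group from degree 0 to degree \<open>n\<close>, and the homology of a point is the
  integers. A homeomorphism of pairs carries the result to \<open>'a\<close>.\<close>

lemma relative_homology_group_punctured_euclidean:
  "relative_homology_group (int DIM('a)) (euclidean :: 'a::euclidean_space topology) (- {0}) \<cong> integer_group"
proof -
  let ?n = "DIM('a)" and ?z = "\<lambda>i::nat. 0::real"
  have ts0: "topspace (Euclidean_space 0) = {?z}"
    by (auto simp: topspace_Euclidean_space)
  obtain f and g :: "'a \<Rightarrow> nat \<Rightarrow> real" where "homeomorphic_maps (Euclidean_space ?n) euclidean f g"
    using homeomorphic_maps_Euclidean_space_euclidean by blast
  \<comment> \<open>The homeomorphism \<open>f\<close> need not send the zero sequence to 0, so a
    translation corrects it.\<close>
  moreover have "homeomorphic_maps (euclidean :: 'a topology) euclidean (\<lambda>x. x - f ?z) (\<lambda>x. x + f ?z)"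
    by (auto simp: homeomorphic_maps_def intro!: continuous_intros)
  ultimately have "homeomorphic_maps (Euclidean_space ?n) euclidean ((\<lambda>x. x - f ?z) \<circ> f) (g \<circ> (\<lambda>x. x + f ?z))"
    using homeomorphic_maps_compose by blast
  then have h: "homeomorphic_map (Euclidean_space ?n) euclidean (\<lambda>x. f x - f ?z)"
    by (auto simp: o_def dest: homeomorphic_maps_imp_map)
  let ?h = "\<lambda>x. f x - f ?z"
  have z: "?z \<in> topspace (Euclidean_space ?n)"
    by (simp add: topspace_Euclidean_space)
  have "?h ` (topspace (Euclidean_space ?n) - {?z}) = ?h ` topspace (Euclidean_space ?n) - ?h ` {?z}"
    using h z by (intro inj_on_image_set_diff[where C = "topspace (Euclidean_space ?n)"]) (auto simp: homeomorphic_map_def)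
  also have "\<dots> = - {0}"
    using homeomorphic_imp_surjective_map[OF h] by auto
  finally have im: "?h ` (topspace (Euclidean_space ?n) - {?z}) = - {0}" .
  have "relative_homology_group (int ?n) (Euclidean_space ?n) (topspace (Euclidean_space ?n) - {?z})
      \<cong> relative_homology_group (int ?n) (euclidean :: 'a topology) (- {0})"
    using homeomorphic_map_relative_homology_iso[OF h _ im] by (intro is_isoI) auto
  moreover have "relative_homology_group 0 (Euclidean_space 0) (topspace (Euclidean_space 0) - {?z})
      \<cong> relative_homology_group (0 + int ?n) (Euclidean_space (0 + ?n)) (topspace (Euclidean_space (0 + ?n)) - {?z})"
    by (rule relative_homology_group_Euclidean_complement_step) (metis closedin_topspace ts0)
  moreover have "homology_group 0 (Euclidean_space 0) \<cong> integer_group"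
    using ts0 by (rule homology_coefficients)
  ultimately show ?thesis
    by (simp add: ts0) (meson group.iso_sym group_integer_group group_relative_homology_group iso_trans)
qed

text \<open>With \<open>K = {0}\<close>, the local class passes through H_m(E, E - {0}), on which
  \<open>f\<close> acts as the \<open>d\<close>-th power. The exponent is determined because that
  group is infinite cyclic and its generator comes from some local class \<open>c\<close>.\<close>

lemma brouwer_degree_eqI:
  fixes f :: "'a::euclidean_space \<Rightarrow> 'a"
  assumes "open U" "0 \<in> U" and cont: "continuous_on UNIV f"
    and zero: "\<And>x. f x = 0 \<longleftrightarrow> x = 0"
    and pow: "\<And>v. v \<in> carrier (relative_homology_group (int DIM('a)) euclidean (- {0})) \<Longrightarrow>
      hom_induced (int DIM('a)) euclidean (- {0}) euclidean (- {0}) f v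
        = v [^]\<^bsub>relative_homology_group (int DIM('a)) (euclidean :: 'a topology) (- {0})\<^esub> d"
  shows "brouwer_degree f U 0 = d"
proof -
  let ?m = "int DIM('a)"
  let ?H = "relative_homology_group ?m (euclidean :: 'a topology) (- {0})"
  have K: "{x \<in> U. f x = 0} = {0}"
    using zero \<open>0 \<in> U\<close> by auto
  \<comment> \<open>\<open>f\<close> is defined on the whole space, so excision is needed only to see that \<open>d\<close> is unique,
    and for that the radius \<open>r = 0\<close> suffices.\<close>
  have push: "hom_induced ?m (top_of_set U) (U - {0}) euclidean (- {0}) f c
     = hom_induced ?m euclidean (- {0}) euclidean (- {0}) f
         (hom_induced ?m (top_of_set U) (U - {0}) euclidean (- {0}) id c)" for c
    using cont zero by (subst hom_induced_compose') auto
  have "closure (- U) \<subseteq> interior (- {0})"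
    using \<open>open U\<close> \<open>0 \<in> U\<close> by (simp add: closure_closed interior_open closed_Compl open_Compl)
  then have excision: "hom_induced ?m (top_of_set U) (U - {0}) euclidean (- {0}) id
      \<in> iso (relative_homology_group ?m (top_of_set U) (U - {0})) ?H"
    using homology_excision_axiom[of euclidean "- U" "- {0}" UNIV ?m]
    by (simp add: Diff_eq Int_commute)
  obtain \<phi> where "\<phi> \<in> iso integer_group ?H"
    using relative_homology_group_punctured_euclidean[where 'a='a]
    by (meson group.iso_sym group_relative_homology_group is_iso_def ex_in_conv)
  then interpret \<phi>: group_hom integer_group ?H \<phi>
    by (simp add: group_hom_axioms_def group_hom_def iso_imp_homomorphism)
  define v where "v = \<phi> 1"
  have v: "v \<in> carrier ?H"
    by (simp add: v_def \<phi>.hom_closed)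
  have pow_v: "v [^]\<^bsub>?H\<^esub> k = \<phi> k" for k :: int
    by (simp add: v_def \<phi>.hom_int_pow[symmetric])
  have inj: "inj \<phi>"
    using \<open>\<phi> \<in> iso integer_group ?H\<close> by (simp add: iso_def bij_betw_def)
  have "v \<in> hom_induced ?m (top_of_set U) (U - {0}) euclidean (- {0}) id `
      carrier (relative_homology_group ?m (top_of_set U) (U - {0}))"
    using excision v by (simp add: iso_def bij_betw_def)
  then obtain c where c: "c \<in> carrier (relative_homology_group ?m (top_of_set U) (U - {0}))"
    "hom_induced ?m (top_of_set U) (U - {0}) euclidean (- {0}) id c = v"
    by blast
  show ?thesis
    unfolding brouwer_degree_def K Let_def
  proof (rule the_equality, intro allI impI)
    fix r u c
    assume sub: "insert 0 {0} \<subseteq> cball (0::'a) r"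
      and u: "u \<in> carrier (relative_homology_group ?m (euclidean :: 'a topology) (- cball 0 r))"
      and eq: "hom_induced ?m (top_of_set U) (U - {0}) euclidean (- {0}) id c =
         hom_induced ?m euclidean (- cball 0 r) euclidean (- {0}) id u"
    show "hom_induced ?m (top_of_set U) (U - {0}) euclidean (- {0}) f c
        = hom_induced ?m euclidean (- cball 0 r) euclidean (- {0}) id u [^]\<^bsub>?H\<^esub> d"
      unfolding push eq by (rule pow) (rule hom_induced_carrier)
  next
    fix d' :: int
    assume *: "\<forall>r u c. insert 0 {0} \<subseteq> cball (0::'a) r \<longrightarrow>
       u \<in> carrier (relative_homology_group ?m (euclidean :: 'a topology) (- cball 0 r)) \<longrightarrow>
       c \<in> carrier (relative_homology_group ?m (top_of_set U) (U - {0})) \<longrightarrow>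
       hom_induced ?m (top_of_set U) (U - {0}) euclidean (- {0}) id c =
         hom_induced ?m euclidean (- cball 0 r) euclidean (- {0}) id u \<longrightarrow>
       hom_induced ?m (top_of_set U) (U - {0}) euclidean (- {0}) f c =
         (hom_induced ?m euclidean (- cball 0 r) euclidean (- {0}) id u) [^]\<^bsub>?H\<^esub> d'"
    have "v [^]\<^bsub>?H\<^esub> d = v [^]\<^bsub>?H\<^esub> d'"
      using *[rule_format, of 0 v c] v c pow[OF v] by (simp add: hom_induced_id push)
    then show "d' = d"
      using inj by (simp add: pow_v inj_eq)
  qed
qed

lemma brouwer_degree_homotopic_idI:
  fixes H :: "real \<times> 'a::euclidean_space \<Rightarrow> 'a"
  assumes "open U" "0 \<in> U" and cont: "continuous_on UNIV H"
    and zero: "\<And>t x. 0 \<le> t \<Longrightarrow> t \<le> 1 \<Longrightarrow> H (t, x) = 0 \<longleftrightarrow> x = 0"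
    and id: "\<And>x. H (1, x) = x"
  shows "brouwer_degree (\<lambda>x. H (0, x)) U 0 = 1"
proof (rule brouwer_degree_eqI)
  let ?H = "relative_homology_group (int DIM('a)) (euclidean :: 'a topology) (- {0})"
  interpret group ?H
    by simp
  fix v assume v: "v \<in> carrier ?H"
  have "homotopic_with (\<lambda>h. h \<in> - {0} \<rightarrow> - {0}) euclidean euclidean (\<lambda>x. H (0, x)) id"
    using homotopic_with_euclideanI[OF cont, of "- {0}" "- {0}"] zero by (simp add: id id_def)
  from homology_homotopy_axiom[OF this] v
  show "hom_induced (int DIM('a)) euclidean (- {0}) euclidean (- {0}) (\<lambda>x. H (0, x)) v = v [^]\<^bsub>?H\<^esub> (1::int)"
    by (simp add: hom_induced_id int_pow_1)
qed (use assms in \<open>auto intro!: continuous_intros continuous_on_compose2[OF cont]\<close>)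

text \<open>At time 1 the map misses 0, so it factors through the pair (E - {0}, E - {0}), whose
  relative homology is trivial. The induced map therefore kills every class.\<close>

lemma brouwer_degree_homotopic_nonsurjI:
  fixes H :: "real \<times> 'a::euclidean_space \<Rightarrow> 'a"
  assumes "open U" "0 \<in> U" and cont: "continuous_on UNIV H"
    and zero: "\<And>t x. 0 \<le> t \<Longrightarrow> t \<le> 1 \<Longrightarrow> H (t, x) = 0 \<longleftrightarrow> t = 0 \<and> x = 0"
  shows "brouwer_degree (\<lambda>x. H (0, x)) U 0 = 0"
proof (rule brouwer_degree_eqI)
  let ?m = "int DIM('a)"
  let ?H = "relative_homology_group ?m (euclidean :: 'a topology) (- {0})"
  interpret group ?H
    by simp
  have cont1: "continuous_on UNIV (\<lambda>x. H (1, x))"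
    by (auto intro!: continuous_intros continuous_on_compose2[OF cont])
  fix v assume v: "v \<in> carrier ?H"
  have "homotopic_with (\<lambda>h. h \<in> - {0} \<rightarrow> - {0}) euclidean euclidean (\<lambda>x. H (0, x)) (\<lambda>x. H (1, x))"
    using homotopic_with_euclideanI[OF cont, of "- {0}" "- {0}"] zero by simp
  then have "hom_induced ?m euclidean (- {0}) euclidean (- {0}) (\<lambda>x. H (0, x)) v
      = hom_induced ?m euclidean (- {0}) euclidean (- {0}) (\<lambda>x. H (1, x)) v"
    by (simp add: homology_homotopy_axiom)
  also have "\<dots> = hom_induced ?m (top_of_set (- {0})) (- {0}) euclidean (- {0}) id
      (hom_induced ?m euclidean (- {0}) (top_of_set (- {0})) (- {0}) (\<lambda>x. H (1, x)) v)"
    using zero cont1 by (subst hom_induced_compose') (auto simp: continuous_map_in_subtopology o_def)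
  also have "hom_induced ?m euclidean (- {0}) (top_of_set (- {0})) (- {0}) (\<lambda>x. H (1, x)) v
      = \<one>\<^bsub>relative_homology_group ?m (top_of_set (- {0})) (- {0})\<^esub>"
    using trivial_relative_homology_group_topspace[of ?m "top_of_set (- {0 :: 'a})"]
      hom_induced_carrier[of ?m euclidean "- {0}" "top_of_set (- {0})" "- {0}" "\<lambda>x. H (1, x)" v]
    by (simp add: trivial_group_def)
  finally show "hom_induced ?m euclidean (- {0}) euclidean (- {0}) (\<lambda>x. H (0, x)) v = v [^]\<^bsub>?H\<^esub> (0::int)"
    by (simp only: int_pow_0 hom_one[OF hom_induced_hom] group_relative_homology_group)
qed (use assms in \<open>auto intro!: continuous_intros continuous_on_compose2[OF cont]\<close>)

text \<open>An injective linear map is a homeomorphism of the pair (E, E - {0}), so it induces an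
  automorphism of an infinite cyclic group. Such an automorphism is the power 1 or -1; which of the
  two is left open.\<close>

lemma brouwer_degree_homotopic_linearI:
  fixes H :: "real \<times> 'a::euclidean_space \<Rightarrow> 'a"
  assumes "open U" "0 \<in> U" and cont: "continuous_on UNIV H"
    and zero: "\<And>t x. 0 \<le> t \<Longrightarrow> t \<le> 1 \<Longrightarrow> H (t, x) = 0 \<longleftrightarrow> x = 0"
    and lin: "linear (\<lambda>x. H (1, x))"
  shows "brouwer_degree (\<lambda>x. H (0, x)) U 0 \<in> {1, -1}"
proof -
  let ?m = "int DIM('a)" and ?L = "\<lambda>x. H (1, x)"
  let ?H = "relative_homology_group ?m (euclidean :: 'a topology) (- {0})"
  let ?h = "hom_induced ?m euclidean (- {0}) euclidean (- {0}) (\<lambda>x. H (0, x))"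
  have injL: "inj ?L"
    using lin zero[of 1] by (simp add: linear_injective_0)
  then have surjL: "surj ?L"
    using lin by (simp add: linear_injective_imp_surjective)
  obtain M where M: "linear M" "\<And>x. M (?L x) = x" "\<And>x. ?L (M x) = x"
    using linear_injective_isomorphism[OF lin injL] by blast
  have "homeomorphic_maps euclidean euclidean ?L M"
    using M lin by (auto simp: homeomorphic_maps_def linear_continuous_on linear_conv_bounded_linear)
  then have hom: "homeomorphic_map euclidean euclidean ?L"
    by (rule homeomorphic_maps_imp_map)
  have "?L ` (- {0}) = - {0}"
    using injL surjL zero[of 1 0] by (simp add: image_set_diff Compl_eq_Diff_UNIV)
  then have "hom_induced ?m euclidean (- {0}) euclidean (- {0}) ?L \<in> iso ?H ?H"
    by (intro homeomorphic_map_relative_homology_iso[OF hom]) auto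
  moreover have "homotopic_with (\<lambda>h. h \<in> - {0} \<rightarrow> - {0}) euclidean euclidean (\<lambda>x. H (0, x)) ?L"
    using homotopic_with_euclideanI[OF cont, of "- {0}" "- {0}"] zero by simp
  ultimately have iso: "?h \<in> iso ?H ?H"
    by (simp add: homology_homotopy_axiom)
  interpret G: group ?H
    by simp
  obtain \<phi> where \<phi>iso: "\<phi> \<in> iso integer_group ?H"
    using relative_homology_group_punctured_euclidean[where 'a='a]
    by (meson group.iso_sym group_relative_homology_group is_iso_def ex_in_conv)
  interpret \<phi>: group_hom integer_group ?H \<phi>
    using \<phi>iso by (simp add: group_hom_axioms_def group_hom_def iso_imp_homomorphism)
  interpret h: group_hom ?H ?H ?h
    using iso by (simp add: group_hom_axioms_def group_hom_def iso_imp_homomorphism)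
  define v where "v = \<phi> 1"
  have v: "v \<in> carrier ?H"
    by (simp add: v_def \<phi>.hom_closed)
  have pow_v: "\<phi> k = v [^]\<^bsub>?H\<^esub> k" for k :: int
    by (simp add: v_def \<phi>.hom_int_pow[symmetric])
  have inj\<phi>: "inj \<phi>" and gen: "\<And>w. w \<in> carrier ?H \<Longrightarrow> \<exists>k::int. w = v [^]\<^bsub>?H\<^esub> k"
    using \<phi>iso by (auto simp: iso_def bij_betw_def pow_v[symmetric])
  obtain d :: int where d: "?h v = v [^]\<^bsub>?H\<^esub> d"
    using gen h.hom_closed v by blast
  have "v \<in> ?h ` carrier ?H"
    using iso v by (simp add: iso_def bij_betw_def)
  then obtain w where w: "w \<in> carrier ?H" "?h w = v"
    by blast
  obtain k :: int where k: "w = v [^]\<^bsub>?H\<^esub> k"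
    using gen w by blast
  have hpow: "?h (v [^]\<^bsub>?H\<^esub> j) = (v [^]\<^bsub>?H\<^esub> j) [^]\<^bsub>?H\<^esub> d" for j :: int
    using v d by (simp add: h.hom_int_pow G.int_pow_pow mult.commute)
  \<comment> \<open>Surjectivity writes the generator as the image of its \<open>k\<close>-th power,
    which makes \<open>d\<close> a unit.\<close>
  have "\<phi> (k * d) = \<phi> 1"
    using w hpow[of k] v unfolding k by (simp add: G.int_pow_pow pow_v v_def[symmetric] G.int_pow_1)
  then have "k * d = 1"
    using inj\<phi> by (simp add: inj_eq)
  then have "d \<in> {1, -1}"
    by (metis insertCI zmult_eq_1_iff)
  moreover have "brouwer_degree (\<lambda>x. H (0, x)) U 0 = d"
  proof (rule brouwer_degree_eqI)
    fix w assume "w \<in> carrier ?H"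
    then show "?h w = w [^]\<^bsub>?H\<^esub> d"
      using gen hpow by metis
  qed (use assms in \<open>auto intro!: continuous_intros continuous_on_compose2[OF cont]\<close>)
  ultimately show ?thesis
    by simp
qed

section \<open>The degree of the min map\<close>

lemma LCP_solution_iff:
  fixes A :: "real^'n^'n"
  shows "LCP_solution A q x \<longleftrightarrow>
    (\<forall>i. 0 \<le> x $ i \<and> 0 \<le> (A *v x) $ i + q $ i \<and> (x $ i = 0 \<or> (A *v x) $ i + q $ i = 0))"
proof (cases "\<forall>i. 0 \<le> x $ i \<and> 0 \<le> (A *v x) $ i + q $ i")
  case True
  then have "x \<bullet> (A *v x + q) = 0 \<longleftrightarrow> (\<forall>i. x $ i * ((A *v x) $ i + q $ i) = 0)"
    by (simp add: inner_vec_def sum_nonneg_eq_0_iff)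
  with True show ?thesis
    by (auto simp: LCP_solution_def less_eq_vec_def)
qed (auto simp: LCP_solution_def less_eq_vec_def)

lemma min_eq_0_iff_LCP_solution:
  fixes A :: "real^'n^'n"
  shows "(\<chi> i. min (x $ i) ((A *v x) $ i + q $ i)) = 0 \<longleftrightarrow> LCP_solution A q x"
  unfolding LCP_solution_iff vec_eq_iff by (auto simp: min_def) (metis order_antisym linorder_le_cases)+

lemma LCP_solution_scale:
  fixes A :: "real^'n^'n"
  assumes "LCP_solution A q x" "0 \<le> c"
  shows "LCP_solution A (c *\<^sub>R q) (c *\<^sub>R x)"
  using assms unfolding LCP_solution_iff
  by (simp add: matrix_vector_mult_scaleR distrib_left[symmetric]) blast

lemma continuous_on_matrix_vector_mult:
  fixes A :: "real^'n^'m"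
  assumes "continuous_on S f"
  shows "continuous_on S (\<lambda>x. A *v f x)"
  by (rule bounded_linear.continuous_on[OF matrix_vector_mul_bounded_linear assms])

lemma brouwer_degree_min_map_eq_0:
  fixes A :: "real^'n^'n"
  assumes "open U" "0 \<in> U" "R0_matrix A" "\<not> Q_matrix A"
  shows "brouwer_degree (min_map A) U 0 = 0"
proof -
  obtain q where q: "\<And>x. \<not> LCP_solution A q x"
    using assms by (auto simp: Q_matrix_def)
  define H where "H = (\<lambda>(t::real, x). \<chi> i. min (x $ i) ((A *v x) $ i + (t *\<^sub>R q) $ i))"
  have "continuous_on UNIV H"
    unfolding H_def case_prod_unfold
    by (intro continuous_intros continuous_on_matrix_vector_mult)
  moreover have "H (t, x) = 0 \<longleftrightarrow> t = 0 \<and> x = 0" if "0 \<le> t" "t \<le> 1" for t x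
  proof (cases "t = 0")
    case True
    then show ?thesis
      using assms min_eq_0_iff_LCP_solution[of x A 0] by (simp add: H_def R0_matrix_def)
  next
    case False
    \<comment> \<open>Dividing a solution for \<open>t q\<close> by \<open>t > 0\<close> would give
      a solution for \<open>q\<close>.\<close>
    have "\<not> LCP_solution A (t *\<^sub>R q) x"
      using LCP_solution_scale[of A "t *\<^sub>R q" x "1 / t"] q[of "(1 / t) *\<^sub>R x"] that False by auto
    then have "H (t, x) \<noteq> 0"
      unfolding min_eq_0_iff_LCP_solution[symmetric] by (simp add: H_def)
    with False show ?thesis
      by simp
  qed
  moreover have "min_map A = (\<lambda>x. H (0, x))"
    by (auto simp: H_def min_map_def)
  ultimately show ?thesis
    using assms brouwer_degree_homotopic_nonsurjI[of U H] by simp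
qed

text \<open>The second argument of the minimum moves linearly from \<open>A x\<close> to
  \<open>x\<close>. For \<open>t < 1\<close> it is a positive multiple of
  \<open>(A + \<tau> I) x\<close> with \<open>\<tau> = t / (1 - t)\<close>, and a positive factor in
  one argument does not change where the minimum vanishes.\<close>

lemma brouwer_degree_min_map_eq_1:
  fixes A :: "real^'n^'n"
  assumes "open U" "0 \<in> U" and R0: "\<And>\<tau>. 0 \<le> \<tau> \<Longrightarrow> R0_matrix (A + mat \<tau>)"
  shows "brouwer_degree (min_map A) U 0 = 1"
proof -
  define H where "H = (\<lambda>(t::real, x). \<chi> i. min (x $ i) ((1 - t) * (A *v x) $ i + t * x $ i))"
  have "continuous_on UNIV H"
    unfolding H_def case_prod_unfold
    by (intro continuous_intros continuous_on_matrix_vector_mult)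
  moreover have "H (t, x) = 0 \<longleftrightarrow> x = 0" if "0 \<le> t" "t \<le> 1" for t x
  proof (cases "t = 1")
    case True
    then show ?thesis
      by (simp add: H_def vec_eq_iff)
  next
    case False
    with that have "0 < 1 - t" "0 \<le> t / (1 - t)"
      by auto
    have mv: "mat c *v y = c *\<^sub>R y" for c and y :: "real^'n"
      by (simp add: vec_eq_iff matrix_vector_mult_def mat_def if_distrib[of "\<lambda>a. a * _"] cong: if_cong)
    have "H (t, x) = 0 \<longleftrightarrow> (\<forall>i. min (x $ i) ((1 - t) * ((A + mat (t / (1 - t))) *v x) $ i) = 0)"
      using False by (simp add: H_def vec_eq_iff matrix_vector_mult_add_rdistrib mv distrib_left)
    also have "\<dots> \<longleftrightarrow> (\<forall>i. min (x $ i) (((A + mat (t / (1 - t))) *v x) $ i) = 0)"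
    proof (intro all_cong1)
      show "min a ((1 - t) * b) = 0 \<longleftrightarrow> min a b = 0" for a b :: real
        using \<open>0 < 1 - t\<close> mult_pos_pos[of "1 - t" b] mult_pos_neg[of "1 - t" b]
        by (cases b "0::real" rule: linorder_cases) (auto simp: min_def split: if_splits)
    qed
    also have "\<dots> \<longleftrightarrow> LCP_solution (A + mat (t / (1 - t))) 0 x"
      by (simp add: min_eq_0_iff_LCP_solution[symmetric] vec_eq_iff)
    also have "\<dots> \<longleftrightarrow> x = 0"
      using R0[OF \<open>0 \<le> t / (1 - t)\<close>] by (simp add: R0_matrix_def)
    finally show ?thesis .
  qed
  moreover have "H (1, x) = x" for x
    by (simp add: H_def vec_eq_iff)
  moreover have "min_map A = (\<lambda>x. H (0, x))"
    by (auto simp: H_def min_map_def)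
  ultimately show ?thesis
    using assms brouwer_degree_homotopic_idI[of U H] by simp
qed

text \<open>The deformation raises only the first argument of the minimum, by a multiple
  \<open>k\<close> of \<open>p\<close>, until the second argument \<open>A y\<close> is always the
  smaller one. Substituting \<open>x = y + k p\<close> turns a zero into a solution \<open>x\<close>
  of the problem with vector \<open>-k A p\<close>, and uniqueness gives
  \<open>y = 0\<close>.\<close>

lemma brouwer_degree_min_map_unit:
  fixes A :: "real^'n^'n"
  assumes "open U" "0 \<in> U" and p: "\<And>i. 0 < p $ i"
    and uniq: "\<And>y k. 0 \<le> k \<Longrightarrow> LCP_solution A (- (k *\<^sub>R (A *v p))) (y + k *\<^sub>R p) \<Longrightarrow> y = 0"
  shows "brouwer_degree (min_map A) U 0 \<in> {1, -1}"
proof -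
  obtain K where K: "\<And>x. norm (A *v x) \<le> norm x * K"
    using bounded_linear.bounded[OF matrix_vector_mul_bounded_linear[of A]] by blast
  \<comment> \<open>\<open>C\<close> is so large that \<open>C |y| p\<close> dominates
    \<open>A y - y\<close> in every component; the sum over all indices serves as a bound on the
    maximum.\<close>
  obtain C where C: "0 \<le> C" "\<And>i. 1 + \<bar>K\<bar> \<le> C * p $ i"
  proof
    let ?C = "\<Sum>i\<in>UNIV. (1 + \<bar>K\<bar>) / p $ i"
    show "0 \<le> ?C"
      using p by (intro sum_nonneg) (simp add: less_imp_le)
    fix i
    have "(1 + \<bar>K\<bar>) / p $ i \<le> ?C"
      using p by (intro member_le_sum) (auto simp: less_imp_le)
    then show "1 + \<bar>K\<bar> \<le> ?C * p $ i"
      using p[of i] by (simp add: pos_divide_le_eq)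
  qed
  define H where "H = (\<lambda>(t::real, y). \<chi> i. min (y $ i + t * C * norm y * p $ i) ((A *v y) $ i))"
  have "continuous_on UNIV H"
    unfolding H_def case_prod_unfold
    by (intro continuous_intros continuous_on_matrix_vector_mult)
  moreover have "H (t, y) = 0 \<longleftrightarrow> y = 0" if "0 \<le> t" "t \<le> 1" for t y
  proof
    assume "H (t, y) = 0"
    define k where "k = t * C * norm y"
    have "(\<chi> i. min ((y + k *\<^sub>R p) $ i) ((A *v (y + k *\<^sub>R p)) $ i + (- (k *\<^sub>R (A *v p))) $ i)) = H (t, y)"
      by (simp add: H_def k_def matrix_vector_right_distrib matrix_vector_mult_scaleR vec_eq_iff)
    with \<open>H (t, y) = 0\<close> have "LCP_solution A (- (k *\<^sub>R (A *v p))) (y + k *\<^sub>R p)"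
      unfolding min_eq_0_iff_LCP_solution[symmetric] by simp
    moreover have "0 \<le> k"
      using that C by (simp add: k_def)
    ultimately show "y = 0"
      by (rule uniq[rotated])
  next
    assume "y = 0"
    show "H (t, y) = 0"
      unfolding \<open>y = 0\<close> by (simp add: H_def vec_eq_iff)
  qed
  moreover have "H (1, y) = A *v y" for y
  proof -
    have "(A *v y) $ i \<le> y $ i + C * norm y * p $ i" for i
    proof -
      have "(A *v y) $ i - y $ i \<le> norm (A *v y) + norm y"
        using component_le_norm_cart[of "A *v y" i] component_le_norm_cart[of y i] by linarith
      also have "\<dots> \<le> norm y * \<bar>K\<bar> + norm y"
        using K[of y] mult_left_mono[OF abs_ge_self[of K] norm_ge_zero[of y]] by linarith
      also have "\<dots> = norm y * (1 + \<bar>K\<bar>)"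
        by (simp add: algebra_simps)
      also have "\<dots> \<le> norm y * (C * p $ i)"
        using C by (simp add: mult_left_mono)
      finally show ?thesis
        by (simp add: algebra_simps)
    qed
    then show ?thesis
      by (simp add: H_def vec_eq_iff min_absorb2)
  qed
  moreover have "min_map A = (\<lambda>x. H (0, x))"
    by (auto simp: H_def min_map_def)
  ultimately show ?thesis
    using assms brouwer_degree_homotopic_linearI[of U H] by (simp add: matrix_vector_mul_linear)
qed

section \<open>Cyclic bidiagonal matrices\<close>

text \<open>The numbering is replaced by its cyclic successor \<open>\<sigma>\<close>, so that the
  corner entry in the last row is treated like every other off-diagonal entry. Transitivity makes
  \<open>\<sigma>\<close> a single cycle on the finite index type.\<close>

locale cyclic_bidiagonal =
  fixes A :: "real^'n^'n" and \<sigma> :: "'n \<Rightarrow> 'n" and d s :: "'n \<Rightarrow> real"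
  assumes row: "(A *v x) $ i = d i * x $ i + s i * x $ \<sigma> i"
    and transitive: "\<exists>m. (\<sigma> ^^ m) i = j"
begin

section \<open>Propagation around the cycle\<close>

lemma backward_to_cut:
  assumes "P j" and step: "\<And>i. i \<noteq> k \<Longrightarrow> P (\<sigma> i) \<Longrightarrow> P i"
  shows "P (\<sigma> k)"
proof -
  have "P ((\<sigma> ^^ m) (\<sigma> k)) \<Longrightarrow> P (\<sigma> k)" for m
  proof (induction m)
    case (Suc m)
    \<comment> \<open>If the \<open>m\<close>-th iterate is \<open>k\<close>, the next one is
      \<open>\<sigma> k\<close>, so the premise is already the goal.\<close>
    then show ?case
      using step by (cases "(\<sigma> ^^ m) (\<sigma> k) = k") auto
  qed simp
  then show ?thesis
    using transitive[of "\<sigma> k" j] \<open>P j\<close> by auto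
qed

lemma backward:
  assumes "P j" and step: "\<And>i. P (\<sigma> i) \<Longrightarrow> P i"
  shows "P i"
  using backward_to_cut[of P j i] assms by blast

lemma forward:
  assumes "P j" and step: "\<And>i. P i \<Longrightarrow> P (\<sigma> i)"
  shows "P i"
proof -
  have "P ((\<sigma> ^^ m) j)" for m
    by (induction m) (use assms in auto)
  then show ?thesis
    using transitive[of j i] by auto
qed

text \<open>Following the cycle from \<open>\<sigma> j\<close> leads back to \<open>j\<close>, and
  \<open>t\<close> never drops on the way.\<close>

lemma no_strict_increase:
  fixes t :: "'n \<Rightarrow> real"
  assumes "\<And>i. t i \<le> t (\<sigma> i)"
  shows "t (\<sigma> j) \<le> t j"
  using forward[of "\<lambda>i. t (\<sigma> j) \<le> t i" "\<sigma> j" j] assms order_trans by blast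

lemma LCP_iff:
  "LCP_solution A q x \<longleftrightarrow> (\<forall>i. 0 \<le> x $ i \<and> 0 \<le> d i * x $ i + s i * x $ \<sigma> i + q $ i \<and>
     (x $ i = 0 \<or> d i * x $ i + s i * x $ \<sigma> i + q $ i = 0))"
  by (simp add: LCP_solution_iff row)

section \<open>Sign conditions forced by solvability\<close>

lemma Q_matrixE:
  fixes q :: "'n \<Rightarrow> real"
  assumes "Q_matrix A"
  obtains x :: "real^'n" where "\<And>i. 0 \<le> x $ i" "\<And>i. 0 \<le> d i * x $ i + s i * x $ \<sigma> i + q i"
    "\<And>i. x $ i = 0 \<or> d i * x $ i + s i * x $ \<sigma> i + q i = 0"
proof -
  obtain x where "LCP_solution A (\<chi> i. q i) x"
    using assms by (auto simp: Q_matrix_def)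
  then show ?thesis
    by (intro that[of x]) (auto simp: LCP_iff)
qed

text \<open>Test vector: -1 everywhere. A row without a positive coefficient cannot make up for the
  -1.\<close>

lemma Q_matrix_row_positive:
  assumes "Q_matrix A"
  shows "0 < d i \<or> 0 < s i"
proof (rule ccontr)
  assume neg: "\<not> ?thesis"
  obtain x where x: "\<And>i. 0 \<le> x $ i" "\<And>i. 0 \<le> d i * x $ i + s i * x $ \<sigma> i + - 1"
    "\<And>i. x $ i = 0 \<or> d i * x $ i + s i * x $ \<sigma> i + - 1 = 0"
    using Q_matrixE[OF assms, of "\<lambda>i. - 1"] by blast
  have "d i * x $ i \<le> 0" "s i * x $ \<sigma> i \<le> 0"
    using neg x(1) by (auto intro: mult_nonpos_nonneg)
  with x(2)[of i] show False
    by linarith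
qed

text \<open>The test vector is 1 at \<open>l\<close> and where \<open>d\<close> is positive, and -1
  elsewhere. Row \<open>l\<close> is then positive, so \<open>x\<close> vanishes at
  \<open>l\<close>; zeros spread backward to all of \<open>x\<close>, which leaves the infeasible
  value -1 in row \<open>j\<close>.\<close>

lemma Q_matrix_nonneg_row:
  assumes "Q_matrix A" "0 \<le> d l" "0 \<le> s l" "j \<noteq> l"
  shows "0 < d j"
proof (rule ccontr)
  assume neg: "\<not> 0 < d j"
  obtain x where x: "\<And>i. 0 \<le> x $ i"
    "\<And>i. 0 \<le> d i * x $ i + s i * x $ \<sigma> i + (if i = l \<or> 0 < d i then 1 else - 1)"
    "\<And>i. x $ i = 0 \<or> d i * x $ i + s i * x $ \<sigma> i + (if i = l \<or> 0 < d i then 1 else - 1) = 0"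
    using Q_matrixE[OF assms(1), of "\<lambda>i. if i = l \<or> 0 < d i then 1 else - 1"] by blast
  have "0 \<le> d l * x $ l" "0 \<le> s l * x $ \<sigma> l"
    using x(1) assms by auto
  with x(3)[of l] have xl: "x $ l = 0"
    by auto
  have "x $ i = 0" for i
  proof (rule backward[of "\<lambda>i. x $ i = 0", OF xl])
    fix i assume *: "x $ \<sigma> i = 0"
    \<comment> \<open>When the next component vanishes, row \<open>i\<close> is either positive,
      forcing a zero by complementarity, or at most -1, contradicting feasibility.\<close>
    have "0 < d i \<Longrightarrow> 0 \<le> d i * x $ i" "\<not> 0 < d i \<Longrightarrow> d i * x $ i \<le> 0"
      using x(1)[of i] by (auto intro: mult_nonpos_nonneg)
    with * x(2,3)[of i] xl show "x $ i = 0"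
      by (cases "i = l"; cases "0 < d i") auto
  qed
  with x(2)[of j] neg assms show False
    by simp
qed

text \<open>Row \<open>k\<close> is nonnegative, which settles the sign of \<open>d j\<close>. For
  \<open>s j\<close> the test vector is -1 at \<open>k\<close> and 1 elsewhere: if
  \<open>s j\<close> were nonnegative, \<open>x\<close> would vanish at \<open>j\<close>, hence
  backward up to \<open>\<sigma> k\<close>, and row \<open>k\<close> would equal -1.\<close>

lemma Q_matrix_zero_diagonal:
  assumes "Q_matrix A" "d k = 0" "j \<noteq> k"
  shows "0 < d j" "s j < 0"
proof -
  have sk: "0 < s k"
    using Q_matrix_row_positive[OF assms(1), of k] assms(2) by simp
  have dpos: "0 < d i" if "i \<noteq> k" for i
    using Q_matrix_nonneg_row[OF assms(1), of k i] assms(2) sk that by simp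
  then show "0 < d j"
    using assms by simp
  show "s j < 0"
  proof (rule ccontr)
    assume "\<not> s j < 0"
    obtain x where x: "\<And>i. 0 \<le> x $ i"
      "\<And>i. 0 \<le> d i * x $ i + s i * x $ \<sigma> i + (if i = k then - 1 else 1)"
      "\<And>i. x $ i = 0 \<or> d i * x $ i + s i * x $ \<sigma> i + (if i = k then - 1 else 1) = 0"
      using Q_matrixE[OF assms(1), of "\<lambda>i. if i = k then - 1 else 1"] by blast
    have "0 \<le> d j * x $ j" "0 \<le> s j * x $ \<sigma> j"
      using x(1) dpos[OF assms(3)] \<open>\<not> s j < 0\<close> by (auto simp: less_imp_le)
    with x(3)[of j] assms have "x $ j = 0"
      by auto
    then have "x $ \<sigma> k = 0"
    proof (rule backward_to_cut[of "\<lambda>i. x $ i = 0"])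
      fix i assume "i \<noteq> k" "x $ \<sigma> i = 0"
      moreover have "0 \<le> d i * x $ i"
        using x(1) dpos[OF \<open>i \<noteq> k\<close>] by (simp add: less_imp_le)
      ultimately show "x $ i = 0"
        using x(3)[of i] by auto
    qed
    with x(2)[of k] assms show False
      by simp
  qed
qed

text \<open>A row with both coefficients nonnegative would force \<open>d j\<close> to be positive,
  and each row has a positive coefficient; only opposite signs remain.\<close>

lemma Q_matrix_negative_diagonal:
  assumes "Q_matrix A" "d j < 0"
  shows "d i < 0 \<and> 0 < s i \<or> 0 < d i \<and> s i < 0"
proof (cases "d i < 0")
  case True
  then show ?thesis
    using Q_matrix_row_positive[OF assms(1), of i] by auto
next
  case False
  then have "s i < 0"
    using Q_matrix_nonneg_row[OF assms(1), of i j] assms(2) by force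
  then show ?thesis
    using Q_matrix_row_positive[OF assms(1), of i] by auto
qed

section \<open>Nonnegative diagonal\<close>

text \<open>If the shifted diagonal has a zero, then \<open>\<tau> = 0\<close> and the known signs
  spread a zero of \<open>x\<close> everywhere. Otherwise a nonzero solution \<open>x\<close> is
  positive, and comparison with a strictly positive \<open>z\<close> makes \<open>x / z\<close>
  increase strictly around the cycle.\<close>

lemma R0_matrix_add_mat:
  assumes Q: "Q_matrix A" and d: "\<And>i. 0 \<le> d i" and "0 \<le> \<tau>"
  shows "R0_matrix (A + mat \<tau>)"
proof -
  interpret \<tau>: cyclic_bidiagonal "A + mat \<tau>" \<sigma> "\<lambda>i. d i + \<tau>" s
  proof
    have "(mat \<tau> *v x) $ i = \<tau> * x $ i" for x i
      by (simp add: matrix_vector_mult_def mat_def if_distrib[of "\<lambda>a. a * _"] cong: if_cong)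
    then show "((A + mat \<tau>) *v x) $ i = (d i + \<tau>) * x $ i + s i * x $ \<sigma> i" for x i
      by (simp add: matrix_vector_mult_add_rdistrib row algebra_simps)
  qed (rule transitive)
  have "x = 0" if "LCP_solution (A + mat \<tau>) 0 x" for x
  proof (rule ccontr)
    assume "x \<noteq> 0"
    have x: "\<And>i. 0 \<le> x $ i" "\<And>i. 0 \<le> (d i + \<tau>) * x $ i + s i * x $ \<sigma> i"
      "\<And>i. x $ i = 0 \<or> (d i + \<tau>) * x $ i + s i * x $ \<sigma> i = 0"
      using that by (auto simp: \<tau>.LCP_iff)
    show False
    proof (cases "\<exists>k. d k + \<tau> = 0")
      case True
      then obtain k where k: "d k = 0" "\<tau> = 0"
        using d \<open>0 \<le> \<tau>\<close> by (metis add_nonneg_eq_0_iff)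
      have sk: "0 < s k"
        using Q_matrix_row_positive[OF Q, of k] k by simp
      \<comment> \<open>Row \<open>k\<close> reduces to its off-diagonal term, so complementarity
        gives a zero at \<open>k\<close> or at \<open>\<sigma> k\<close>.\<close>
      obtain j where "x $ j = 0"
        using x(3)[of k] k sk by auto
      then have xk: "x $ \<sigma> k = 0"
      proof (rule backward_to_cut[of "\<lambda>i. x $ i = 0"])
        fix i assume "i \<noteq> k" "x $ \<sigma> i = 0"
        then show "x $ i = 0"
          using x(3)[of i] Q_matrix_zero_diagonal[OF Q k(1), of i] k(2) by auto
      qed
      have "x $ i = 0" for i
      proof (rule forward[of "\<lambda>i. x $ i = 0", OF xk])
        fix i assume "x $ i = 0"
        show "x $ \<sigma> i = 0"
        proof (cases "i = k")
          case False
          \<comment> \<open>Forward propagation uses feasibility instead of complementarity,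
            together with \<open>s i < 0\<close>.\<close>
          have "0 \<le> s i * x $ \<sigma> i"
            using x(2)[of i] \<open>x $ i = 0\<close> by simp
          then show ?thesis
            using Q_matrix_zero_diagonal(2)[OF Q k(1) False] x(1)[of "\<sigma> i"] by (simp add: zero_le_mult_iff)
        qed (simp add: xk)
      qed
      with \<open>x \<noteq> 0\<close> show False
        by (simp add: vec_eq_iff)
    next
      case False
      then have pos: "0 < d i + \<tau>" for i
        using d[of i] \<open>0 \<le> \<tau>\<close> by (metis add_nonneg_nonneg order_le_less)
      have pull_back: "x $ i = 0" if "x $ \<sigma> i = 0" for i
        using x(3)[of i] pos[of i] that by auto
      have xpos: "0 < x $ i" for i
        using backward[of "\<lambda>i. x $ i = 0", OF _ pull_back] \<open>x \<noteq> 0\<close> x(1)[of i] by (metis order_le_less vec_eq_iff zero_index)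
      have eq: "(d i + \<tau>) * x $ i = - s i * x $ \<sigma> i" for i
        using x(3)[of i] xpos[of i] by auto
      have s: "s i < 0" for i
        using eq[of i] mult_pos_pos[OF pos[of i] xpos[of i]] xpos[of "\<sigma> i"]
        by (metis mult_minus_left neg_0_less_iff_less zero_less_mult_pos2)
      have dpos: "0 < d i" for i
        using Q_matrix_row_positive[OF Q, of i] s[of i] by auto
      \<comment> \<open>Solvability for the vector -1 supplies strict inequalities between
        consecutive components of \<open>z\<close>, to be set against the equations for
        \<open>x\<close>.\<close>
      obtain z where z: "\<And>i. 0 \<le> z $ i" "\<And>i. 0 \<le> d i * z $ i + s i * z $ \<sigma> i + - 1"
        "\<And>i. z $ i = 0 \<or> d i * z $ i + s i * z $ \<sigma> i + - 1 = 0"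
        using Q_matrixE[OF Q, of "\<lambda>i. - 1"] by blast
      have dz: "- s i * z $ \<sigma> i < d i * z $ i" for i
        using z(2)[of i] by simp
      have zpos: "0 < z $ i" for i
      proof -
        have "0 \<le> - s i * z $ \<sigma> i"
          using s[of i] z(1) by (simp add: mult_nonpos_nonneg)
        then have "0 < d i * z $ i"
          using dz[of i] by linarith
        then show ?thesis
          using dpos[of i] by (simp add: zero_less_mult_iff)
      qed
      have less: "x $ i / z $ i < x $ \<sigma> i / z $ \<sigma> i" for i
      proof -
        have "d i * (x $ i * z $ \<sigma> i) \<le> (d i + \<tau>) * x $ i * z $ \<sigma> i"
          using \<open>0 \<le> \<tau>\<close> xpos[of i] zpos[of "\<sigma> i"] by (simp add: algebra_simps)
        also have "\<dots> = - s i * z $ \<sigma> i * x $ \<sigma> i"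
          unfolding eq by simp
        also have "\<dots> < d i * z $ i * x $ \<sigma> i"
          using dz[of i] xpos[of "\<sigma> i"] by (rule mult_strict_right_mono)
        finally have "x $ i * z $ \<sigma> i < z $ i * x $ \<sigma> i"
          using dpos[of i] by (simp add: mult.assoc)
        then show ?thesis
          using zpos[of i] zpos[of "\<sigma> i"] by (simp add: divide_simps mult.commute)
      qed
      show False
        using no_strict_increase[of "\<lambda>i. x $ i / z $ i"] less by (meson less_imp_le not_less)
    qed
  qed
  then show ?thesis
    by (auto simp: R0_matrix_def \<tau>.LCP_iff)
qed

section \<open>A negative diagonal entry\<close>

text \<open>The vector \<open>q\<close> is chosen so that zeros of solutions for \<open>k q\<close>
  spread backward for every \<open>k \<ge> 0\<close>. Nonzero solutions are therefore positive and
  solve \<open>A x = -k q\<close>. Here \<open>p\<close> solves the problem for \<open>q\<close>, so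
  \<open>A p = -q\<close>, and injectivity of \<open>A\<close> leaves only
  \<open>x = k p\<close>.\<close>

lemma negative_diagonal_unique:
  assumes Q: "Q_matrix A" and j: "d j < 0"
  obtains p where "\<And>i. 0 < p $ i"
    "\<And>y k. 0 \<le> k \<Longrightarrow> LCP_solution A (- (k *\<^sub>R (A *v p))) (y + k *\<^sub>R p) \<Longrightarrow> y = 0"
proof -
  note ds = Q_matrix_negative_diagonal[OF Q j]
  define q where "q = (\<chi> i. if d i < 0 then - 1 else (0 :: real))"
  have pull_back: "x $ i = 0" if lcp: "LCP_solution A (k *\<^sub>R q) x" and "0 \<le> k" "x $ \<sigma> i = 0" for x k i
  proof -
    have x: "0 \<le> x $ i" "0 \<le> d i * x $ i + k * q $ i" "x $ i = 0 \<or> d i * x $ i + k * q $ i = 0"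
      using lcp \<open>x $ \<sigma> i = 0\<close> unfolding LCP_iff by (metis add.right_neutral mult_zero_right vector_scaleR_component real_scaleR_def)+
    show ?thesis
    proof (cases "d i < 0")
      case True
      then have "0 \<le> d i * x $ i"
        using x(2) \<open>0 \<le> k\<close> by (simp add: q_def)
      then show ?thesis
        using True x(1) by (simp add: zero_le_mult_iff)
    next
      case False
      then show ?thesis
        using x(3) ds[of i] by (auto simp: q_def)
    qed
  qed
  have posI: "0 < x $ i" if x: "LCP_solution A (k *\<^sub>R q) x" and "0 \<le> k" "x \<noteq> 0" for x k i
    using backward[of "\<lambda>i. x $ i = 0", OF _ pull_back[OF x]] that x
    by (metis LCP_iff order_le_less vec_eq_iff zero_index)
  have nz: "x \<noteq> 0" if x: "LCP_solution A (k *\<^sub>R q) x" and "0 < k" for x k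
  proof
    assume "x = 0"
    with x have "0 \<le> k * q $ j"
      unfolding LCP_iff by simp
    with j \<open>0 < k\<close> show False
      by (simp add: q_def)
  qed
  have Aeq: "A *v x = - (k *\<^sub>R q)" if "LCP_solution A (k *\<^sub>R q) x" "\<And>i. 0 < x $ i" for x k
    using that by (simp add: LCP_solution_iff vec_eq_iff) (metis add_eq_0_iff2 less_irrefl)
  obtain p where "LCP_solution A q p"
    using Q by (auto simp: Q_matrix_def)
  then have lcp: "LCP_solution A (1 *\<^sub>R q) p"
    by simp
  have p: "0 < p $ i" for i
    using posI[OF lcp _ nz[OF lcp]] by simp
  have Ap: "A *v p = - q"
    using Aeq[OF lcp p] by simp
  \<comment> \<open>A nonzero kernel vector has no zero component, since both coefficients of each
    row are nonzero. It satisfies the homogeneous form of the recursion for \<open>p\<close>, so the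
    two can be compared by their ratio.\<close>
  have inj: "y = 0" if Ay: "A *v y = 0" for y
  proof (rule ccontr)
    assume "y \<noteq> 0"
    have y: "d i * y $ i + s i * y $ \<sigma> i = 0" for i
      using Ay row[of y i] by simp
    have "y $ i = 0" if "y $ \<sigma> i = 0" for i
      using y[of i] ds[of i] that by auto
    then have ynz: "y $ i \<noteq> 0" for i
      using backward[of "\<lambda>i. y $ i = 0"] \<open>y \<noteq> 0\<close> by (metis vec_eq_iff zero_index)
    \<comment> \<open>The opposite signs in each row make this factor positive, so it passes through
      absolute values.\<close>
    define r where "r i = - s i / d i" for i
    have r: "0 < r i" for i
      using ds[of i] by (auto simp: r_def divide_neg_pos divide_pos_neg)
    have yr: "\<bar>y $ i\<bar> = r i * \<bar>y $ \<sigma> i\<bar>" for i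
    proof -
      have "y $ i = r i * y $ \<sigma> i"
        using y[of i] ds[of i] by (auto simp: r_def field_simps)
      then show ?thesis
        using r[of i] by (simp add: abs_mult)
    qed
    have pr: "p $ i = r i * p $ \<sigma> i - q $ i / d i" for i
    proof -
      have "d i * p $ i = - s i * p $ \<sigma> i - q $ i"
        using Ap row[of p i] by simp
      moreover have "d i \<noteq> 0"
        using ds[of i] by auto
      ultimately have "p $ i = (- s i * p $ \<sigma> i - q $ i) / d i"
        by (metis nonzero_mult_div_cancel_left)
      then show ?thesis
        by (simp add: r_def diff_divide_distrib)
    qed
    have ratio: "p $ i / \<bar>y $ i\<bar> = p $ \<sigma> i / \<bar>y $ \<sigma> i\<bar> - q $ i / d i / \<bar>y $ i\<bar>" for i
      using r[of i] ynz[of "\<sigma> i"] unfolding pr[of i] yr[of i] by (simp add: diff_divide_distrib)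
    \<comment> \<open>Going once around the cycle, the ratio \<open>p / |y|\<close> would never decrease and grow at \<open>j\<close>.\<close>
    have "p $ \<sigma> j / \<bar>y $ \<sigma> j\<bar> \<le> p $ j / \<bar>y $ j\<bar>"
    proof (rule no_strict_increase)
      fix i
      have "0 \<le> q $ i / d i / \<bar>y $ i\<bar>"
        by (rule divide_nonneg_nonneg) (simp_all add: q_def divide_nonpos_neg)
      then show "p $ i / \<bar>y $ i\<bar> \<le> p $ \<sigma> i / \<bar>y $ \<sigma> i\<bar>"
        using ratio[of i] by linarith
    qed
    moreover have "0 < q $ j / d j / \<bar>y $ j\<bar>"
      using j ynz[of j] by (simp add: q_def divide_neg_neg mult_neg_pos)
    ultimately show False
      using ratio[of j] by linarith
  qed
  show thesis
  proof (rule that)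
    show "0 < p $ i" for i
      by (rule p)
    fix y and k :: real assume k: "0 \<le> k" and "LCP_solution A (- (k *\<^sub>R (A *v p))) (y + k *\<^sub>R p)"
    then have lcp: "LCP_solution A (k *\<^sub>R q) (y + k *\<^sub>R p)"
      by (simp add: Ap)
    show "y = 0"
    proof (cases "y + k *\<^sub>R p = 0")
      case True
      then show ?thesis
        \<comment> \<open>The zero vector is infeasible at \<open>j\<close> for
          \<open>k > 0\<close>; hence \<open>k = 0\<close> and \<open>y = 0\<close>.\<close>
        using nz[OF lcp] k by (cases "k = 0") auto
    next
      case False
      have "A *v (y + k *\<^sub>R p) = - (k *\<^sub>R q)"
        using Aeq[OF lcp] posI[OF lcp k False] by blast
      then have "A *v y = 0"
        by (simp add: matrix_vector_right_distrib matrix_vector_mult_scaleR Ap)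
      then show ?thesis
        by (rule inj)
    qed
  qed
qed

section \<open>The equivalence, and its transfer to bdsw matrices\<close>

theorem Q_matrix_iff_degree:
  assumes U: "open U" "0 \<in> U"
  shows "Q_matrix A \<longleftrightarrow> R0_matrix A \<and> brouwer_degree (min_map A) U 0 \<in> {1, -1}"
proof
  assume Q: "Q_matrix A"
  show "R0_matrix A \<and> brouwer_degree (min_map A) U 0 \<in> {1, -1}"
  proof (cases "\<exists>j. d j < 0")
    case True
    then obtain j where "d j < 0"
      by blast
    from negative_diagonal_unique[OF Q this] obtain p where p: "\<And>i. 0 < p $ i"
      "\<And>y k. 0 \<le> k \<Longrightarrow> LCP_solution A (- (k *\<^sub>R (A *v p))) (y + k *\<^sub>R p) \<Longrightarrow> y = 0"
      by blast
    \<comment> \<open>Uniqueness at \<open>k = 0\<close> concerns the homogeneous problem.\<close>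
    have "R0_matrix A"
      using p(2)[of 0] by (auto simp: R0_matrix_def LCP_iff[of 0 0])
    moreover have "brouwer_degree (min_map A) U 0 \<in> {1, -1}"
      using U p by (rule brouwer_degree_min_map_unit)
    ultimately show ?thesis ..
  next
    case False
    then have R0: "R0_matrix (A + mat \<tau>)" if "0 \<le> \<tau>" for \<tau>
      using R0_matrix_add_mat[OF Q _ that] by (meson not_less)
    then show ?thesis
      using R0[of 0] brouwer_degree_min_map_eq_1[OF U R0] by (simp add: mat_0)
  qed
next
  assume deg: "R0_matrix A \<and> brouwer_degree (min_map A) U 0 \<in> {1, -1}"
  show "Q_matrix A"
  proof (rule ccontr)
    assume "\<not> Q_matrix A"
    then have "brouwer_degree (min_map A) U 0 = 0"
      using brouwer_degree_min_map_eq_0[OF U] deg by blast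
    with deg show False
      by simp
  qed
qed

end

lemma bdsw_imp_cyclic_bidiagonal:
  fixes A :: "real^'n^'n" and e :: "nat \<Rightarrow> 'n::finite"
  assumes n: "CARD('n) \<ge> 2" and e: "bij_betw e {1..CARD('n)} UNIV" and A: "bdsw e A"
  obtains \<sigma> d s where "cyclic_bidiagonal A \<sigma> d s"
proof -
  let ?n = "CARD('n)"
  define suc where "suc a = (if a = ?n then 1 else a + 1)" for a
  define \<sigma> where "\<sigma> i = e (suc (the_inv_into {1..?n} e i))" for i
  have inj: "inj_on e {1..?n}"
    using e by (simp add: bij_betw_def)
  have \<sigma>_e: "\<sigma> (e a) = e (suc a)" if "a \<in> {1..?n}" for a
    unfolding \<sigma>_def the_inv_into_f_f[OF inj that] ..
  have suc: "suc a \<in> {1..?n}" "suc a \<noteq> a" if "a \<in> {1..?n}" for a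
    using that n by (auto simp: suc_def)
  have ex: "\<exists>a\<in>{1..?n}. i = e a" for i
    using e unfolding bij_betw_def by blast
  have "(A *v x) $ i = A $ i $ i * x $ i + A $ i $ \<sigma> i * x $ \<sigma> i" for x i
  proof -
    obtain a where a: "a \<in> {1..?n}" "i = e a"
      using ex by blast
    \<comment> \<open>With at least two indices, the diagonal and the off-diagonal entry of a row
      are distinct and are not counted twice.\<close>
    have "\<sigma> i \<noteq> i"
      using a suc[of a] by (simp add: \<sigma>_e inj_on_eq_iff[OF inj])
    have zero: "A $ i $ j = 0" if "j \<notin> {i, \<sigma> i}" for j
    proof -
      obtain b where b: "b \<in> {1..?n}" "j = e b"
        using ex by blast
      then have "b \<noteq> a" "b \<noteq> suc a"
        using that a by (auto simp: \<sigma>_e)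
      then show ?thesis
        using A a b by (auto simp: bdsw_def suc_def split: if_splits)
    qed
    then have "(\<Sum>j\<in>UNIV. A $ i $ j * x $ j) = (\<Sum>j\<in>{i, \<sigma> i}. A $ i $ j * x $ j)"
      by (intro sum.mono_neutral_right) simp_all
    then show ?thesis
      using \<open>\<sigma> i \<noteq> i\<close> by (simp add: matrix_vector_mult_def)
  qed
  moreover have "\<exists>m. (\<sigma> ^^ m) i = j" for i j
  proof -
    obtain a where a: "a \<in> {1..?n}" "i = e a"
      using ex by blast
    obtain b where b: "b \<in> {1..?n}" "j = e b"
      using ex by blast
    \<comment> \<open>To get from number \<open>a\<close> to number \<open>b\<close>: climb
      \<open>n - a\<close> steps to \<open>n\<close>, take one step around to 1, then climb
      \<open>b - 1\<close> steps.\<close>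
    have climb: "1 \<le> c \<Longrightarrow> c + m \<le> ?n \<Longrightarrow> (\<sigma> ^^ m) (e c) = e (c + m)" for c m
      by (induction m) (auto simp: \<sigma>_e suc_def)
    have "(\<sigma> ^^ Suc (?n - a)) i = e 1"
      using climb[of a "?n - a"] a by (simp add: \<sigma>_e suc_def)
    then have "(\<sigma> ^^ (b - 1 + Suc (?n - a))) i = (\<sigma> ^^ (b - 1)) (e 1)"
      unfolding funpow_add by simp
    also have "\<dots> = j"
      using climb[of 1 "b - 1"] b by simp
    finally show ?thesis
      by blast
  qed
  ultimately show thesis
    by (intro that[of \<sigma> "\<lambda>i. A $ i $ i" "\<lambda>i. A $ i $ \<sigma> i"]) unfold_locales
qed

theorem mainTheorem10:
  fixes A :: "real^'n^'n"
    and e :: "nat \<Rightarrow> 'n::finite"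
    and \<Omega> :: "(real^'n) set"
  assumes "CARD('n) \<ge> 2"
    and "bij_betw e {1..CARD('n)} UNIV"
    and "bdsw e A"
    and "open \<Omega>" and "bounded \<Omega>" and "0 \<in> \<Omega>"
  shows "Q_matrix A \<longleftrightarrow>
    R0_matrix A \<and> brouwer_degree (min_map A) \<Omega> 0 \<in> {1, -1}"
proof -
  obtain \<sigma> d s where "cyclic_bidiagonal A \<sigma> d s"
    using bdsw_imp_cyclic_bidiagonal assms(1-3) by blast
  then show ?thesis
    using \<open>open \<Omega>\<close> \<open>0 \<in> \<Omega>\<close> by (rule cyclic_bidiagonal.Q_matrix_iff_degree)
qed

end
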